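(* Let $1\le p<q<\infty$ and $1\le r<\infty$. There is a constant $K>0$ such that if $y\in\ell^1(\mathbb Z)$, then $y\in\ell^p_{q,r}(\mathbb Z)$ and $$\|y\|_{\ell^p_{q,r}}\le K\|y\|_{\ell^1}.$$
   Context: For $j\in\mathbb N_0=\{0,1,2,\dots\}$ and $k\in\mathbb Z$ let $I(j,k)=[2^jk,2^j(k+1))\cap\mathbb Z$ (a discrete dyadic interval with $2^j$ elements). For a real sequence $x=(x(k))_{k\in\mathbb Z}$ put $$\|x\|_{\ell^p_{q,r}}=\Big(\sum_{j=0}^\infty\sum_{k\in\mathbb Z}(2^j)^{r(\frac1q-\frac1p)}\Big(\sum_{l\in I(j,k)}|x(l)|^p\Big)^{r/p}\Big)^{1/r},$$ and let $\ell^p_{q,r}(\mathbb Z)$ be the space of all $x\in\mathbb R^{\mathbb Z}$ with $\|x\|_{\ell^p_{q,r}}<\infty$. *)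

theory Defs
  imports "HOL-Analysis.Analysis"
begin

definition dyadic_interval :: "nat \<Rightarrow> int \<Rightarrow> int set" where
  "dyadic_interval j k = {2 ^ j * k ..< 2 ^ j * (k + 1)}"

(* Intended for s > 0 only, where infinity to the power s is infinity. *)
definition ennpowr :: "ennreal \<Rightarrow> real \<Rightarrow> ennreal" where
  "ennpowr a s = (if a = \<infinity> then \<infinity> else ennreal (enn2real a powr s))"

(* Extended-valued, so that a divergent sum gives norm infinity (a real-valued
   infsum would give 0). The sum over an interval I(j,k) is finite, hence real. *)
definition lpqr_norm :: "real \<Rightarrow> real \<Rightarrow> real \<Rightarrow> (int \<Rightarrow> real) \<Rightarrow> ennreal" where
  "lpqr_norm p q r x =
     ennpowr (\<Sum>\<^sub>\<infinity>j\<in>(UNIV :: nat set). \<Sum>\<^sub>\<infinity>k\<in>(UNIV :: int set).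
       ennreal ((2 ^ j) powr (r * (1 / q - 1 / p)) *
         (\<Sum>l\<in>dyadic_interval j k. \<bar>x l\<bar> powr p) powr (r / p))) (1 / r)"

definition lpqr_space :: "real \<Rightarrow> real \<Rightarrow> real \<Rightarrow> (int \<Rightarrow> real) set" where
  "lpqr_space p q r = {x. lpqr_norm p q r x < \<infinity>}"

definition l1_space :: "(int \<Rightarrow> real) set" where
  "l1_space = {y. (\<lambda>k. \<bar>y k\<bar>) summable_on UNIV}"

(* Meaningful only on l1_space: infsum of a divergent family is 0. *)
definition l1_norm :: "(int \<Rightarrow> real) \<Rightarrow> real" where
  "l1_norm y = (\<Sum>\<^sub>\<infinity>k\<in>UNIV. \<bar>y k\<bar>)"

end

theory Submission
  imports Defs
begin

text \<open>
  The embedding rests on one inequality: for an exponent \<open>t \<ge> 1\<close> and nonnegative numbers, the sum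
  of the \<open>t\<close>-th powers is at most the \<open>t\<close>-th power of the sum (\<open>sum_powr_le_powr_sum\<close>).

  Let \<open>S\<close> be the \<open>\<ell>\<^sup>1\<close>-norm of \<open>y\<close>. The exponent \<open>p\<close> bounds the inner \<open>\<ell>\<^sup>p\<close>-norm over a dyadic
  interval by the mass of \<open>|y|\<close> on it. At a fixed level \<open>j\<close> the intervals are disjoint, so these
  masses add up to at most \<open>S\<close>, and the exponent \<open>r\<close> shows that the sum of their \<open>r\<close>-th powers is at
  most \<open>S\<^sup>r\<close>, uniformly in \<open>j\<close> (\<open>dyadic_level_le\<close>). What remains is the weight of level \<open>j\<close>, the power
  \<open>\<theta>\<^sup>j\<close> with \<open>\<theta> = 2 powr (r * (1/q - 1/p))\<close>. Since \<open>p < q\<close>, this ratio is below 1, and the geometric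
  series gives the bound with constant \<open>(1 / (1 - \<theta>)) powr (1/r)\<close>.
\<close>

text \<open>Each term satisfies \<open>a\<^sup>t = a a\<^sup>t\<^sup>-\<^sup>1 \<le> a s\<^sup>t\<^sup>-\<^sup>1\<close>, where \<open>s\<close> is the whole sum.\<close>

lemma sum_powr_le_powr_sum:
  fixes f :: "'a \<Rightarrow> real"
  assumes "finite A" and nonneg: "\<And>x. x \<in> A \<Longrightarrow> 0 \<le> f x" and "1 \<le> t"
  shows "(\<Sum>x\<in>A. f x powr t) \<le> (\<Sum>x\<in>A. f x) powr t"
proof -
  define s where "s = (\<Sum>x\<in>A. f x)"
  have split: "a powr t = a * a powr (t - 1)" if "0 \<le> a" for a :: real
    using powr_add[of a 1 "t - 1"] that by simp
  have "f x powr t \<le> f x * s powr (t - 1)" if "x \<in> A" for x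
  proof -
    have "f x \<le> s"
      unfolding s_def using that nonneg \<open>finite A\<close> by (intro member_le_sum) auto
    then have "f x powr (t - 1) \<le> s powr (t - 1)"
      using that nonneg \<open>1 \<le> t\<close> by (intro powr_mono2) auto
    then show ?thesis
      using that nonneg by (simp add: split mult_left_mono)
  qed
  then have "(\<Sum>x\<in>A. f x powr t) \<le> (\<Sum>x\<in>A. f x * s powr (t - 1))"
    by (rule sum_mono)
  also have "\<dots> = s * s powr (t - 1)"
    by (simp add: s_def sum_distrib_right)
  also have "\<dots> = s powr t"
    using nonneg by (simp add: s_def split sum_nonneg)
  finally show ?thesis by (simp add: s_def)
qed

lemma finite_dyadic_interval [simp]: "finite (dyadic_interval j k)"
  by (simp add: dyadic_interval_def)

lemma mem_dyadic_interval_iff: "l \<in> dyadic_interval j k \<longleftrightarrow> l div 2 ^ j = k"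
proof -
  have "l div 2 ^ j = k" if "2 ^ j * k \<le> l" "l < 2 ^ j * (k + 1)"
  proof -
    have "l div 2 ^ j = (2 ^ j * k + (l - 2 ^ j * k)) div 2 ^ j" by simp
    also have "\<dots> = k + (l - 2 ^ j * k) div 2 ^ j"
      by (subst div_mult_self4) auto
    also have "(l - 2 ^ j * k) div 2 ^ j = 0"
      using that by (intro div_pos_pos_trivial) (auto simp: algebra_simps)
    finally show ?thesis by simp
  qed
  moreover have "2 ^ j * (l div 2 ^ j) \<le> l \<and> l < 2 ^ j * (l div 2 ^ j + 1)"
  proof -
    have "2 ^ j * (l div 2 ^ j) + l mod 2 ^ j = l" by (rule mult_div_mod_eq)
    moreover have "0 \<le> l mod 2 ^ j" "l mod 2 ^ j < 2 ^ j" by simp_all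
    ultimately show ?thesis by (simp only: distrib_left mult_1_right) linarith
  qed
  ultimately show ?thesis by (auto simp: dyadic_interval_def)
qed

lemma sum_dyadic_intervals_le_l1_norm:
  assumes "y \<in> l1_space" and "finite F"
  shows "(\<Sum>k\<in>F. \<Sum>l\<in>dyadic_interval j k. \<bar>y l\<bar>) \<le> l1_norm y"
proof -
  have "(\<Sum>k\<in>F. \<Sum>l\<in>dyadic_interval j k. \<bar>y l\<bar>)
      = (\<Sum>l\<in>(\<Union>k\<in>F. dyadic_interval j k). \<bar>y l\<bar>)"
    using \<open>finite F\<close>
    by (intro sum.UNION_disjoint[symmetric]) (auto simp: mem_dyadic_interval_iff)
  also have "\<dots> \<le> l1_norm y"
    unfolding l1_norm_def using assms
    by (intro finite_sum_le_infsum) (auto simp: l1_space_def)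
  finally show ?thesis .
qed

text \<open>The \<open>\<ell>\<^sup>p\<close> sums over the intervals become \<open>\<ell>\<^sup>1\<close> sums by the power inequality with exponent \<open>p\<close>,
  and a second use with exponent \<open>r\<close> pulls the \<open>r\<close>-th power out of the sum over the intervals.\<close>

lemma dyadic_level_le:
  assumes "y \<in> l1_space" and "finite F" and "1 \<le> p" and "1 \<le> r"
  shows "(\<Sum>k\<in>F. (\<Sum>l\<in>dyadic_interval j k. \<bar>y l\<bar> powr p) powr (r / p)) \<le> l1_norm y powr r"
proof -
  define m where "m k = (\<Sum>l\<in>dyadic_interval j k. \<bar>y l\<bar>)" for k
  have m_nonneg: "0 \<le> m k" for k
    by (simp add: m_def sum_nonneg)
  have "(\<Sum>l\<in>dyadic_interval j k. \<bar>y l\<bar> powr p) powr (r / p) \<le> m k powr r" for k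
  proof -
    have "(\<Sum>l\<in>dyadic_interval j k. \<bar>y l\<bar> powr p) powr (r / p) \<le> (m k powr p) powr (r / p)"
      unfolding m_def using assms
      by (intro powr_mono2 sum_powr_le_powr_sum) (auto intro!: sum_nonneg)
    then show ?thesis
      using \<open>1 \<le> p\<close> by (simp add: powr_powr)
  qed
  then have "(\<Sum>k\<in>F. (\<Sum>l\<in>dyadic_interval j k. \<bar>y l\<bar> powr p) powr (r / p)) \<le> (\<Sum>k\<in>F. m k powr r)"
    by (rule sum_mono)
  also have "\<dots> \<le> (\<Sum>k\<in>F. m k) powr r"
    using assms m_nonneg by (intro sum_powr_le_powr_sum) auto
  also have "\<dots> \<le> l1_norm y powr r"
    using assms m_nonneg sum_dyadic_intervals_le_l1_norm[of y F j]
    by (intro powr_mono2) (auto simp: m_def intro!: sum_nonneg)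
  finally show ?thesis .
qed

lemma infsum_ennreal_le:
  fixes f :: "'a \<Rightarrow> ennreal"
  assumes "\<And>F. finite F \<Longrightarrow> F \<subseteq> A \<Longrightarrow> sum f F \<le> c"
  shows "infsum f A \<le> c"
  using assms by (intro infsum_le_finite_sums nonneg_summable_on_complete) auto

lemma ennpowr_le:
  assumes "a \<le> ennreal c" and "0 \<le> c" and "0 \<le> s"
  shows "ennpowr a s \<le> ennreal (c powr s)"
proof -
  have "a \<noteq> \<infinity>"
    using assms(1) by (auto simp: top_unique)
  moreover have "enn2real a \<le> c"
    using assms enn2real_leI by blast
  ultimately show ?thesis
    using \<open>0 \<le> s\<close> by (auto simp: ennpowr_def intro!: ennreal_leI powr_mono2)
qed

theorem proposition4p1:
  fixes p q r :: real
  assumes "1 \<le> p" and "p < q" and "1 \<le> r"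
  shows "\<exists>K::real. K > 0 \<and>
    (\<forall>y\<in>l1_space. y \<in> lpqr_space p q r \<and>
       lpqr_norm p q r y \<le> ennreal (K * l1_norm y))"
proof -
  define e where "e = r * (1 / q - 1 / p)"
  define \<theta> :: real where "\<theta> = 2 powr e"
  have "1 / q < 1 / p"
    using assms by (simp add: field_simps)
  then have "e < 0"
    using assms by (simp add: e_def mult_pos_neg)
  then have \<theta>: "0 < \<theta>" "\<theta> < 1"
    by (auto simp: \<theta>_def powr_less_one)
  have weight: "(2 ^ j) powr e = \<theta> ^ j" for j :: nat
    by (simp add: \<theta>_def powr_powr powr_power mult.commute flip: powr_realpow)
  define K where "K = (1 / (1 - \<theta>)) powr (1 / r)"
  have "K > 0"
    using \<theta> by (simp add: K_def)
  moreover have bound: "lpqr_norm p q r y \<le> ennreal (K * l1_norm y)" if y: "y \<in> l1_space" for y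
  proof -
    define S where "S = l1_norm y"
    have "0 \<le> S"
      by (simp add: S_def l1_norm_def infsum_nonneg)
    define a where "a j k = (\<Sum>l\<in>dyadic_interval j k. \<bar>y l\<bar> powr p) powr (r / p)" for j k
    have level: "(\<Sum>\<^sub>\<infinity>k. ennreal (\<theta> ^ j * a j k)) \<le> ennreal (\<theta> ^ j * S powr r)" for j
    proof (rule infsum_ennreal_le)
      fix F :: "int set" assume "finite F"
      have "(\<Sum>k\<in>F. ennreal (\<theta> ^ j * a j k)) = ennreal (\<theta> ^ j * (\<Sum>k\<in>F. a j k))"
        using \<theta> by (subst sum_ennreal) (auto simp: a_def sum_distrib_left)
      also have "\<dots> \<le> ennreal (\<theta> ^ j * S powr r)"
        unfolding a_def S_def using \<theta> dyadic_level_le[OF y \<open>finite F\<close> assms(1,3)]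
        by (intro ennreal_leI mult_left_mono) auto
      finally show "(\<Sum>k\<in>F. ennreal (\<theta> ^ j * a j k)) \<le> ennreal (\<theta> ^ j * S powr r)" .
    qed
    have "(\<Sum>\<^sub>\<infinity>j. \<Sum>\<^sub>\<infinity>k. ennreal (\<theta> ^ j * a j k)) \<le> ennreal (1 / (1 - \<theta>) * S powr r)"
    proof (rule infsum_ennreal_le)
      fix J :: "nat set" assume "finite J"
      have "(\<Sum>j\<in>J. \<Sum>\<^sub>\<infinity>k. ennreal (\<theta> ^ j * a j k)) \<le> (\<Sum>j\<in>J. ennreal (\<theta> ^ j * S powr r))"
        by (intro sum_mono level)
      also have "\<dots> = ennreal ((\<Sum>j\<in>J. \<theta> ^ j) * S powr r)"
        using \<theta> by (subst sum_ennreal) (auto simp: sum_distrib_right)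
      also have "\<dots> \<le> ennreal (1 / (1 - \<theta>) * S powr r)"
      proof (intro ennreal_leI mult_right_mono)
        have "(\<Sum>j\<in>J. \<theta> ^ j) \<le> (\<Sum>j. \<theta> ^ j)"
          using \<theta> \<open>finite J\<close> by (intro sum_le_suminf summable_geometric) auto
        then show "(\<Sum>j\<in>J. \<theta> ^ j) \<le> 1 / (1 - \<theta>)"
          using \<theta> by (simp add: suminf_geometric)
      qed simp
      finally show "(\<Sum>j\<in>J. \<Sum>\<^sub>\<infinity>k. ennreal (\<theta> ^ j * a j k)) \<le> ennreal (1 / (1 - \<theta>) * S powr r)" .
    qed
    then have "lpqr_norm p q r y \<le> ennreal ((1 / (1 - \<theta>) * S powr r) powr (1 / r))"
      unfolding lpqr_norm_def weight[unfolded e_def] a_def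
      using \<theta> \<open>1 \<le> r\<close> by (intro ennpowr_le) auto
    also have "(1 / (1 - \<theta>) * S powr r) powr (1 / r) = K * S"
      using \<theta> \<open>1 \<le> r\<close> \<open>0 \<le> S\<close> by (subst powr_mult) (auto simp: K_def powr_powr)
    finally show ?thesis by (simp add: S_def)
  qed
  moreover have "y \<in> lpqr_space p q r" if "y \<in> l1_space" for y
    using bound[OF that] by (auto simp: lpqr_space_def intro: le_less_trans)
  ultimately show ?thesis by blast
qed

end
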